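(* Let $a\in\mathbb{C}^*$, $b\in\mathbb{C}$, and let $N$ be one of the $\mathfrak{sl}_2(\mathbb{C})$-modules $F_{(a,1)}(M_b)$, $F_{(a,1)}(M_b')$, $F_\tau\circ F_{(a,1)}(M_b')$. Then the central character $\chi_N$ of $N$ is determined by $$\chi_N(c_2)=2b(b+1),\qquad\text{where } c_2=2h^2+e_{1,2}e_{2,1}+e_{2,1}e_{1,2}.$$
   Context: $e_{i,j}$ are matrix units, $h:=\frac12(e_{1,1}-e_{2,2})$, and $\sigma$ is the algebra automorphism of $\mathbb{C}[h]$ with $\sigma(h)=h-1$. $M_b$ is the vector space $\mathbb{C}[h]$ with $\mathfrak{sl}_2$-action $h\cdot f=hf$, $e_{1,2}\cdot f=(h+b)\sigma f$, $e_{2,1}\cdot f=-(h-b)\sigma^{-1}f$. $M_b'$ is the vector space $\mathbb{C}[h]$ with $h\cdot f=hf$, $e_{1,2}\cdot f=\sigma f$, $e_{2,1}\cdot f=-(h+b+1)(h-b)\sigma^{-1}f$. For an automorphism $\varphi$ of $\mathcal{U}(\mathfrak{sl}_2)$, $F_\varphi$ sends a module to the same vector space with new action $x\bullet v=\varphi(x)\cdot v$. $F_\tau$ corresponds to $\tau(e_{i,j})=-e_{j,i}$; $F_{(a_1,a_2)}$ corresponds to $e_{i,j}\mapsto\frac{a_i}{a_j}e_{i,j}$. The central character of a module $N$ is the algebra homomorphism $\chi_N$ from the center of $\mathcal{U}(\mathfrak{sl}_2)$ to $\mathbb{C}$ such that $z\cdot v=\chi_N(z)v$ for all central $z$ and all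 $v\in N$. The center of $\mathcal{U}(\mathfrak{sl}_2)$ is $\mathbb{C}[c_2]$. *)

theory Defs
  imports "HOL-Analysis.Analysis" "HOL-Computational_Algebra.Polynomial"
begin

section \<open>The Lie algebra of traceless complex 2 by 2 matrices\<close>

typedef sl2 = "{A :: complex^2^2. trace A = 0}"
  by (rule exI[of _ 0]) (simp add: trace_def)

setup_lifting type_definition_sl2

instantiation sl2 :: ab_group_add
begin

lift_definition zero_sl2 :: sl2 is 0 by (simp add: trace_def)
lift_definition plus_sl2 :: "sl2 \<Rightarrow> sl2 \<Rightarrow> sl2" is "(+)" by (simp add: trace_add)
lift_definition minus_sl2 :: "sl2 \<Rightarrow> sl2 \<Rightarrow> sl2" is "(-)" by (simp add: trace_sub)
lift_definition uminus_sl2 :: "sl2 \<Rightarrow> sl2" is uminus by (simp add: trace_def sum_negf)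

instance by standard (transfer; simp)+

end

lift_definition sl2_scale :: "complex \<Rightarrow> sl2 \<Rightarrow> sl2"
  is "\<lambda>c A. \<chi> i j. c * A $ i $ j"
  by (simp add: trace_def flip: sum_distrib_left)

lift_definition sl2_bracket :: "sl2 \<Rightarrow> sl2 \<Rightarrow> sl2"
  is "\<lambda>A B. A ** B - B ** A"
  by (simp only: trace_sub right_minus_eq) (rule trace_mul_sym)

definition mat_unit :: "2 \<Rightarrow> 2 \<Rightarrow> complex^2^2"
  where "mat_unit i j = (\<chi> k l. if k = i \<and> l = j then 1 else 0)"

lift_definition sl2_h :: sl2 is "(1/2) *\<^sub>R (mat_unit 1 1 - mat_unit 2 2)"
  by (simp add: trace_def mat_unit_def sum_2)
lift_definition sl2_e12 :: sl2 is "mat_unit 1 2"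
  by (simp add: trace_def mat_unit_def sum_2)
lift_definition sl2_e21 :: sl2 is "mat_unit 2 1"
  by (simp add: trace_def mat_unit_def sum_2)

lemma sl2_basis_entries:
  "Rep_sl2 sl2_h $ 1 $ 1 = 1/2" "Rep_sl2 sl2_h $ 1 $ 2 = 0"
  "Rep_sl2 sl2_h $ 2 $ 1 = 0" "Rep_sl2 sl2_h $ 2 $ 2 = -1/2"
  "Rep_sl2 sl2_e12 $ 1 $ 1 = 0" "Rep_sl2 sl2_e12 $ 1 $ 2 = 1"
  "Rep_sl2 sl2_e12 $ 2 $ 1 = 0" "Rep_sl2 sl2_e12 $ 2 $ 2 = 0"
  "Rep_sl2 sl2_e21 $ 1 $ 1 = 0" "Rep_sl2 sl2_e21 $ 1 $ 2 = 0"
  "Rep_sl2 sl2_e21 $ 2 $ 1 = 1" "Rep_sl2 sl2_e21 $ 2 $ 2 = 0"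
  by (simp_all add: sl2_h.rep_eq sl2_e12.rep_eq sl2_e21.rep_eq mat_unit_def complex_eq_iff)

text \<open>Linear extension of \<open>e\<^sub>i\<^sub>j \<mapsto> - e\<^sub>j\<^sub>i\<close>.\<close>

lift_definition sl2_tau :: "sl2 \<Rightarrow> sl2" is "\<lambda>A. - transpose A"
  by (simp add: trace_def transpose_def sum_negf)

text \<open>Linear extension of \<open>e\<^sub>i\<^sub>j \<mapsto> (a\<^sub>i / a\<^sub>j) e\<^sub>i\<^sub>j\<close>; meaningful only if both
  \<open>a\<^sub>1\<close> and \<open>a\<^sub>2\<close> are nonzero (otherwise the trace need not vanish).\<close>

definition sl2_diag :: "complex^2 \<Rightarrow> sl2 \<Rightarrow> sl2"
  where "sl2_diag a x = Abs_sl2 (\<chi> i j. a $ i / a $ j * Rep_sl2 x $ i $ j)"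

definition sl2_endomorphism :: "(sl2 \<Rightarrow> sl2) \<Rightarrow> bool"
  where "sl2_endomorphism \<phi> \<longleftrightarrow>
    (\<forall>x y. \<phi> (x + y) = \<phi> x + \<phi> y) \<and>
    (\<forall>c x. \<phi> (sl2_scale c x) = sl2_scale c (\<phi> x)) \<and>
    (\<forall>x y. \<phi> (sl2_bracket x y) = sl2_bracket (\<phi> x) (\<phi> y))"

lemma Rep_sl2_diag:
  assumes "a $ 1 \<noteq> 0" "a $ 2 \<noteq> 0"
  shows "Rep_sl2 (sl2_diag a x) = (\<chi> i j. a $ i / a $ j * Rep_sl2 x $ i $ j)"
proof -
  have "trace (Rep_sl2 x) = 0" using Rep_sl2[of x] by simp
  then have "trace (\<chi> i j. a $ i / a $ j * Rep_sl2 x $ i $ j) = 0"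
    using assms by (simp add: trace_def sum_2)
  then show ?thesis unfolding sl2_diag_def by (subst Abs_sl2_inverse) auto
qed

lemma sl2_endomorphism_tau: "sl2_endomorphism sl2_tau"
  unfolding sl2_endomorphism_def
  by (intro conjI allI; transfer)
    (simp_all add: vec_eq_iff transpose_def matrix_matrix_mult_def mult.commute)

lemma sl2_eqI: "(\<And>i j. Rep_sl2 x $ i $ j = Rep_sl2 y $ i $ j) \<Longrightarrow> x = y"
  by (intro Rep_sl2_inject[THEN iffD1]) (simp add: vec_eq_iff)

lemma sl2_endomorphism_diag:
  assumes a: "a $ 1 \<noteq> 0" "a $ 2 \<noteq> 0"
  shows "sl2_endomorphism (sl2_diag a)"
proof -
  have nz: "a $ k \<noteq> 0" for k using a exhaust_2[of k] by auto
  note R = Rep_sl2_diag[OF a]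
  have "sl2_diag a (x + y) = sl2_diag a x + sl2_diag a y" for x y
    by (rule sl2_eqI) (simp add: R plus_sl2.rep_eq distrib_left)
  moreover have "sl2_diag a (sl2_scale c x) = sl2_scale c (sl2_diag a x)" for c x
    by (rule sl2_eqI) (simp add: R sl2_scale.rep_eq)
  moreover have "sl2_diag a (sl2_bracket x y) = sl2_bracket (sl2_diag a x) (sl2_diag a y)" for x y
  proof (rule sl2_eqI)
    fix i j
    have "(a $ i / a $ k * u) * (a $ k / a $ j * v) = a $ i / a $ j * (u * v)" for k u v
      using nz[of k] by simp
    then show "Rep_sl2 (sl2_diag a (sl2_bracket x y)) $ i $ j =
        Rep_sl2 (sl2_bracket (sl2_diag a x) (sl2_diag a y)) $ i $ j"
      unfolding R sl2_bracket.rep_eq matrix_matrix_mult_def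
      by (simp only: vec_lambda_beta vector_minus_component right_diff_distrib sum_distrib_left)
  qed
  ultimately show ?thesis unfolding sl2_endomorphism_def by blast
qed

lemma sl2_tau_tau: "sl2_tau (sl2_tau x) = x"
  by (rule sl2_eqI) (simp add: sl2_tau.rep_eq transpose_def)

lemma sl2_diag_inverse:
  assumes a: "a $ 1 \<noteq> 0" "a $ 2 \<noteq> 0"
  shows "sl2_diag a (sl2_diag (\<chi> i. inverse (a $ i)) x) = x"
    and "sl2_diag (\<chi> i. inverse (a $ i)) (sl2_diag a x) = x"
proof -
  have nz: "a $ k \<noteq> 0" for k using a exhaust_2[of k] by auto
  have b: "(\<chi> i. inverse (a $ i)) $ 1 \<noteq> 0" "(\<chi> i. inverse (a $ i)) $ 2 \<noteq> 0"
    using a by simp_all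
  show "sl2_diag a (sl2_diag (\<chi> i. inverse (a $ i)) x) = x"
    and "sl2_diag (\<chi> i. inverse (a $ i)) (sl2_diag a x) = x"
    by (rule sl2_eqI; simp add: Rep_sl2_diag[OF a] Rep_sl2_diag[OF b] nz)+
qed


section \<open>The universal enveloping algebra\<close>

text \<open>The unital associative complex algebra with generators \<open>Gen x\<close>, for \<open>x\<close> in the Lie
  algebra, subject to linearity of \<open>Gen\<close> and \<open>Gen [x,y] = Gen x Gen y - Gen y Gen x\<close>: terms in
  scalars and generators modulo the congruence generated by the axioms of a unital algebra
  and these relations.\<close>

datatype uterm = Scal complex | Gen sl2 | Add uterm uterm | Mul uterm uterm

inductive ueq :: "uterm \<Rightarrow> uterm \<Rightarrow> bool" (infix "\<doteq>" 50) where
  ueq_refl: "s \<doteq> s"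
| ueq_sym: "s \<doteq> t \<Longrightarrow> t \<doteq> s"
| ueq_trans: "s \<doteq> t \<Longrightarrow> t \<doteq> u \<Longrightarrow> s \<doteq> u"
| Add_cong: "s \<doteq> s' \<Longrightarrow> t \<doteq> t' \<Longrightarrow> Add s t \<doteq> Add s' t'"
| Mul_cong: "s \<doteq> s' \<Longrightarrow> t \<doteq> t' \<Longrightarrow> Mul s t \<doteq> Mul s' t'"
| Add_assoc: "Add (Add s t) u \<doteq> Add s (Add t u)"
| Add_comm: "Add s t \<doteq> Add t s"
| Add_zero: "Add (Scal 0) s \<doteq> s"
| Add_minus: "Add (Mul (Scal (-1)) s) s \<doteq> Scal 0"
| Mul_assoc: "Mul (Mul s t) u \<doteq> Mul s (Mul t u)"
| Mul_one: "Mul (Scal 1) s \<doteq> s"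
| Mul_Add: "Mul s (Add t u) \<doteq> Add (Mul s t) (Mul s u)"
| Add_Mul: "Mul (Add s t) u \<doteq> Add (Mul s u) (Mul t u)"
| Scal_add: "Scal (c + d) \<doteq> Add (Scal c) (Scal d)"
| Scal_mult: "Scal (c * d) \<doteq> Mul (Scal c) (Scal d)"
| Scal_central: "Mul (Scal c) s \<doteq> Mul s (Scal c)"
| Gen_add: "Gen (x + y) \<doteq> Add (Gen x) (Gen y)"
| Gen_scale: "Gen (sl2_scale c x) \<doteq> Mul (Scal c) (Gen x)"
| Gen_bracket: "Gen (sl2_bracket x y) \<doteq>
    Add (Mul (Gen x) (Gen y)) (Mul (Scal (-1)) (Mul (Gen y) (Gen x)))"

lemma equivp_ueq: "equivp ueq"
  by (intro equivpI reflpI sympI transpI) (blast intro: ueq_refl ueq_sym ueq_trans)+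

quotient_type usl2 = uterm / ueq
  by (rule equivp_ueq)

lift_definition usl2_scalar :: "complex \<Rightarrow> usl2" is Scal .
lift_definition usl2_gen :: "sl2 \<Rightarrow> usl2" is Gen .

text \<open>Evaluating a term under a map from the Lie algebra to the operators on a vector space.\<close>

primrec uterm_act ::
    "(complex \<Rightarrow> 'v \<Rightarrow> 'v) \<Rightarrow> (sl2 \<Rightarrow> 'v \<Rightarrow> 'v) \<Rightarrow> uterm \<Rightarrow> 'v \<Rightarrow> 'v::ab_group_add" where
  "uterm_act scl \<rho> (Scal c) v = scl c v"
| "uterm_act scl \<rho> (Gen x) v = \<rho> x v"
| "uterm_act scl \<rho> (Add s t) v = uterm_act scl \<rho> s v + uterm_act scl \<rho> t v"
| "uterm_act scl \<rho> (Mul s t) v = uterm_act scl \<rho> s (uterm_act scl \<rho> t v)"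

locale sl2_representation = vector_space scale
  for scale :: "complex \<Rightarrow> 'v::ab_group_add \<Rightarrow> 'v" +
  fixes \<rho> :: "sl2 \<Rightarrow> 'v \<Rightarrow> 'v"
  assumes rho_add_right: "\<rho> x (v + w) = \<rho> x v + \<rho> x w"
    and rho_scale_right: "\<rho> x (scale c v) = scale c (\<rho> x v)"
    and rho_add: "\<rho> (x + y) v = \<rho> x v + \<rho> y v"
    and rho_scale: "\<rho> (sl2_scale c x) v = scale c (\<rho> x v)"
    and rho_bracket: "\<rho> (sl2_bracket x y) v = \<rho> x (\<rho> y v) - \<rho> y (\<rho> x v)"
begin

lemma uterm_act_linear:
  "uterm_act scale \<rho> t (v + w) = uterm_act scale \<rho> t v + uterm_act scale \<rho> t w"
  "uterm_act scale \<rho> t (scale c v) = scale c (uterm_act scale \<rho> t v)"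
  by (induction t arbitrary: v w)
    (simp_all add: scale_right_distrib rho_add_right rho_scale_right scale_left_commute
      add_ac mult.commute)

lemma uterm_act_ueq: "s \<doteq> t \<Longrightarrow> uterm_act scale \<rho> s v = uterm_act scale \<rho> t v"
  by (induction arbitrary: v rule: ueq.induct)
    (simp_all add: uterm_act_linear rho_add rho_scale rho_bracket scale_left_distrib)

end

instantiation usl2 :: ring_1
begin

lift_definition zero_usl2 :: usl2 is "Scal 0" .
lift_definition one_usl2 :: usl2 is "Scal 1" .
lift_definition plus_usl2 :: "usl2 \<Rightarrow> usl2 \<Rightarrow> usl2" is Add by (rule Add_cong)
lift_definition times_usl2 :: "usl2 \<Rightarrow> usl2 \<Rightarrow> usl2" is Mul by (rule Mul_cong)
lift_definition uminus_usl2 :: "usl2 \<Rightarrow> usl2" is "Mul (Scal (-1))"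
  by (intro Mul_cong ueq_refl)
definition minus_usl2 :: "usl2 \<Rightarrow> usl2 \<Rightarrow> usl2" where "minus_usl2 x y = x + (- y)"

instance
proof
  fix x y z :: usl2
  show "x + y + z = x + (y + z)" by transfer (rule Add_assoc)
  show "x + y = y + x" by transfer (rule Add_comm)
  show "0 + x = x" by transfer (rule Add_zero)
  show "- x + x = 0" by transfer (rule Add_minus)
  show "x - y = x + - y" by (rule minus_usl2_def)
  show "x * y * z = x * (y * z)" by transfer (rule Mul_assoc)
  show "1 * x = x" by transfer (rule Mul_one)
  show "x * 1 = x" by transfer (blast intro: Mul_one Scal_central ueq_sym ueq_trans)
  show "(x + y) * z = x * z + y * z" by transfer (rule Add_Mul)
  show "x * (y + z) = x * y + x * z" by transfer (rule Mul_Add)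
  interpret trivial: sl2_representation "(*)" "\<lambda>_ _. 0 :: complex"
    by unfold_locales (simp_all add: algebra_simps)
  show "(0::usl2) \<noteq> 1"
    by transfer (use trivial.uterm_act_ueq[of "Scal 0" "Scal 1" 1] in auto)
qed

end

lemma usl2_scalar_0 [simp]: "usl2_scalar 0 = 0" by transfer (rule ueq_refl)
lemma usl2_scalar_1 [simp]: "usl2_scalar 1 = 1" by transfer (rule ueq_refl)
lemma usl2_scalar_add: "usl2_scalar (c + d) = usl2_scalar c + usl2_scalar d"
  by transfer (rule Scal_add)
lemma usl2_scalar_mult: "usl2_scalar (c * d) = usl2_scalar c * usl2_scalar d"
  by transfer (rule Scal_mult)
lemma usl2_scalar_central: "usl2_scalar c * u = u * usl2_scalar c"
  by transfer (rule Scal_central)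
lemma usl2_gen_add: "usl2_gen (x + y) = usl2_gen x + usl2_gen y"
  by transfer (rule Gen_add)
lemma usl2_gen_scale: "usl2_gen (sl2_scale c x) = usl2_scalar c * usl2_gen x"
  by transfer (rule Gen_scale)
lemma usl2_uminus: "- u = usl2_scalar (-1) * u"
  by transfer (rule ueq_refl)
lemma usl2_gen_bracket:
  "usl2_gen (sl2_bracket x y) = usl2_gen x * usl2_gen y - usl2_gen y * usl2_gen x"
  unfolding minus_usl2_def by transfer (rule Gen_bracket)

lemma usl2_induct [case_names scalar gen add mult]:
  assumes "\<And>c. P (usl2_scalar c)" "\<And>x. P (usl2_gen x)"
    "\<And>u v. P u \<Longrightarrow> P v \<Longrightarrow> P (u + v)" "\<And>u v. P u \<Longrightarrow> P v \<Longrightarrow> P (u * v)"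
  shows "P u"
proof -
  obtain t where "u = abs_usl2 t" by (metis Quotient3_abs_rep Quotient3_usl2)
  moreover have "P (abs_usl2 t)"
    by (induction t)
      (use assms in \<open>simp_all flip: usl2_scalar.abs_eq usl2_gen.abs_eq
        plus_usl2.abs_eq times_usl2.abs_eq\<close>)
  ultimately show ?thesis by simp
qed

definition usl2_automorphism :: "(usl2 \<Rightarrow> usl2) \<Rightarrow> bool"
  where "usl2_automorphism \<Phi> \<longleftrightarrow> bij \<Phi> \<and>
    (\<forall>u v. \<Phi> (u + v) = \<Phi> u + \<Phi> v) \<and>
    (\<forall>u v. \<Phi> (u * v) = \<Phi> u * \<Phi> v) \<and>
    (\<forall>c. \<Phi> (usl2_scalar c) = usl2_scalar c)"

text \<open>The extension of a Lie algebra endomorphism to the enveloping algebra. It does not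
  depend on the chosen representative of the congruence class, see \<open>usl2_map_hom\<close>.\<close>

primrec uterm_map :: "(sl2 \<Rightarrow> sl2) \<Rightarrow> uterm \<Rightarrow> uterm" where
  "uterm_map \<phi> (Scal c) = Scal c"
| "uterm_map \<phi> (Gen x) = Gen (\<phi> x)"
| "uterm_map \<phi> (Add s t) = Add (uterm_map \<phi> s) (uterm_map \<phi> t)"
| "uterm_map \<phi> (Mul s t) = Mul (uterm_map \<phi> s) (uterm_map \<phi> t)"

definition usl2_map :: "(sl2 \<Rightarrow> sl2) \<Rightarrow> usl2 \<Rightarrow> usl2"
  where "usl2_map \<phi> u = abs_usl2 (uterm_map \<phi> (rep_usl2 u))"

lemma uterm_map_ueq:
  assumes "sl2_endomorphism \<phi>" "s \<doteq> t"
  shows "uterm_map \<phi> s \<doteq> uterm_map \<phi> t"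
  using assms(2)
proof (induction rule: ueq.induct)
  case (ueq_trans s t u)
  then show ?case by (blast intro: ueq.ueq_trans)
qed (use assms(1) in \<open>auto simp: sl2_endomorphism_def intro: ueq.intros\<close>)

lemma usl2_map_abs:
  assumes "sl2_endomorphism \<phi>"
  shows "usl2_map \<phi> (abs_usl2 t) = abs_usl2 (uterm_map \<phi> t)"
  unfolding usl2_map_def
  by (metis Quotient3_abs_rep Quotient3_usl2 assms usl2.abs_eq_iff uterm_map_ueq)

lemma usl2_map_hom:
  assumes "sl2_endomorphism \<phi>"
  shows "usl2_map \<phi> (usl2_gen x) = usl2_gen (\<phi> x)"
    and "usl2_map \<phi> (usl2_scalar c) = usl2_scalar c"
    and "usl2_map \<phi> (u + v) = usl2_map \<phi> u + usl2_map \<phi> v"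
    and "usl2_map \<phi> (u * v) = usl2_map \<phi> u * usl2_map \<phi> v"
proof -
  show "usl2_map \<phi> (usl2_gen x) = usl2_gen (\<phi> x)"
    by (simp add: usl2_gen.abs_eq usl2_map_abs assms)
  show "usl2_map \<phi> (usl2_scalar c) = usl2_scalar c"
    by (simp add: usl2_scalar.abs_eq usl2_map_abs assms)
  obtain s t where [simp]: "u = abs_usl2 s" "v = abs_usl2 t"
    by (metis Quotient3_abs_rep Quotient3_usl2)
  show "usl2_map \<phi> (u + v) = usl2_map \<phi> u + usl2_map \<phi> v"
    by (simp add: plus_usl2.abs_eq usl2_map_abs assms)
  show "usl2_map \<phi> (u * v) = usl2_map \<phi> u * usl2_map \<phi> v"
    by (simp add: times_usl2.abs_eq usl2_map_abs assms)
qed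

lemma usl2_automorphism_map:
  assumes "sl2_endomorphism \<phi>" "sl2_endomorphism \<psi>"
    and "\<And>x. \<phi> (\<psi> x) = x" "\<And>x. \<psi> (\<phi> x) = x"
  shows "usl2_automorphism (usl2_map \<phi>)"
proof -
  have "usl2_map \<phi> (usl2_map \<psi> u) = u" for u
    by (induction u rule: usl2_induct) (simp_all add: usl2_map_hom assms)
  moreover have "usl2_map \<psi> (usl2_map \<phi> u) = u" for u
    by (induction u rule: usl2_induct) (simp_all add: usl2_map_hom assms)
  ultimately have "bij (usl2_map \<phi>)"
    by (metis bijI')
  then show ?thesis
    by (simp add: usl2_automorphism_def usl2_map_hom assms)
qed

definition usl2_tau :: "usl2 \<Rightarrow> usl2"
  where "usl2_tau = usl2_map sl2_tau"

definition usl2_diag :: "complex^2 \<Rightarrow> usl2 \<Rightarrow> usl2"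
  where "usl2_diag a = usl2_map (sl2_diag a)"

lemma usl2_automorphism_tau: "usl2_automorphism usl2_tau"
  unfolding usl2_tau_def
  by (rule usl2_automorphism_map[OF sl2_endomorphism_tau sl2_endomorphism_tau])
    (rule sl2_tau_tau)+

lemma usl2_automorphism_diag:
  assumes "a $ 1 \<noteq> 0" "a $ 2 \<noteq> 0"
  shows "usl2_automorphism (usl2_diag a)"
  unfolding usl2_diag_def
  by (rule usl2_automorphism_map[where \<psi> = "sl2_diag (\<chi> i. inverse (a $ i))"])
    (use assms in \<open>simp_all add: sl2_endomorphism_diag sl2_diag_inverse\<close>)


section \<open>Modules and central characters\<close>

locale usl2_module = vector_space scale
  for scale :: "complex \<Rightarrow> 'v::ab_group_add \<Rightarrow> 'v" +
  fixes act :: "usl2 \<Rightarrow> 'v \<Rightarrow> 'v"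
  assumes act_add_right: "act u (v + w) = act u v + act u w"
    and act_add: "act (u + u') v = act u v + act u' v"
    and act_mult: "act (u * u') v = act u (act u' v)"
    and act_scalar: "act (usl2_scalar c) v = scale c v"

text \<open>The module structure over the enveloping algebra induced by a representation of the Lie
  algebra; independent of the chosen representative by \<open>uterm_act_ueq\<close>.\<close>

definition usl2_act ::
    "(complex \<Rightarrow> 'v \<Rightarrow> 'v) \<Rightarrow> (sl2 \<Rightarrow> 'v \<Rightarrow> 'v) \<Rightarrow> usl2 \<Rightarrow> 'v \<Rightarrow> 'v::ab_group_add"
  where "usl2_act scl \<rho> u = uterm_act scl \<rho> (rep_usl2 u)"

context sl2_representation
begin

lemma usl2_act_abs: "usl2_act scale \<rho> (abs_usl2 t) v = uterm_act scale \<rho> t v"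
  unfolding usl2_act_def
  by (metis Quotient3_abs_rep Quotient3_usl2 usl2.abs_eq_iff uterm_act_ueq)

lemma usl2_act_gen: "usl2_act scale \<rho> (usl2_gen x) v = \<rho> x v"
  by (simp add: usl2_gen.abs_eq usl2_act_abs)

lemma usl2_module_act: "usl2_module scale (usl2_act scale \<rho>)"
proof
  fix u u' v w c
  obtain s t where [simp]: "u = abs_usl2 s" "u' = abs_usl2 t"
    by (metis Quotient3_abs_rep Quotient3_usl2)
  show "usl2_act scale \<rho> u (v + w) = usl2_act scale \<rho> u v + usl2_act scale \<rho> u w"
    by (simp add: usl2_act_abs uterm_act_linear)
  show "usl2_act scale \<rho> (u + u') v = usl2_act scale \<rho> u v + usl2_act scale \<rho> u' v"
    by (simp add: plus_usl2.abs_eq usl2_act_abs)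
  show "usl2_act scale \<rho> (u * u') v = usl2_act scale \<rho> u (usl2_act scale \<rho> u' v)"
    by (simp add: times_usl2.abs_eq usl2_act_abs)
  show "usl2_act scale \<rho> (usl2_scalar c) v = scale c v"
    by (simp add: usl2_scalar.abs_eq usl2_act_abs)
qed

end

text \<open>The functor \<open>F\<^sub>\<phi>\<close> (on objects) for an automorphism \<open>\<phi>\<close> of the enveloping algebra.\<close>

definition twist :: "(usl2 \<Rightarrow> usl2) \<Rightarrow> (usl2 \<Rightarrow> 'v \<Rightarrow> 'v) \<Rightarrow> usl2 \<Rightarrow> 'v \<Rightarrow> 'v"
  where "twist \<phi> N = (\<lambda>u v. N (\<phi> u) v)"

lemma usl2_module_twist:
  assumes "usl2_automorphism \<phi>" "usl2_module scl N"
  shows "usl2_module scl (twist \<phi> N)"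
proof -
  interpret usl2_module scl N by fact
  show ?thesis
    by standard (use assms(1) in \<open>simp_all add: twist_def usl2_automorphism_def
      act_add_right act_add act_mult act_scalar\<close>)
qed

definition usl2_center :: "usl2 set"
  where "usl2_center = {z. \<forall>u. z * u = u * z}"

text \<open>Algebra homomorphisms from the center to the complex numbers, represented by functions
  that are \<open>undefined\<close> outside the center so that equality is equality on the center.\<close>

definition center_hom :: "(usl2 \<Rightarrow> complex) \<Rightarrow> bool"
  where "center_hom \<kappa> \<longleftrightarrow> \<kappa> \<in> extensional usl2_center \<and>
    (\<forall>y\<in>usl2_center. \<forall>z\<in>usl2_center. \<kappa> (y + z) = \<kappa> y + \<kappa> z) \<and>
    (\<forall>y\<in>usl2_center. \<forall>z\<in>usl2_center. \<kappa> (y * z) = \<kappa> y * \<kappa> z) \<and>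
    (\<forall>c. \<forall>z\<in>usl2_center. \<kappa> (usl2_scalar c * z) = c * \<kappa> z) \<and>
    \<kappa> 1 = 1"

definition is_central_character ::
    "(complex \<Rightarrow> 'v \<Rightarrow> 'v) \<Rightarrow> (usl2 \<Rightarrow> 'v \<Rightarrow> 'v) \<Rightarrow> (usl2 \<Rightarrow> complex) \<Rightarrow> bool"
  where "is_central_character scl N \<kappa> \<longleftrightarrow>
    center_hom \<kappa> \<and> (\<forall>z\<in>usl2_center. \<forall>v. N z v = scl (\<kappa> z) v)"

definition central_character ::
    "(complex \<Rightarrow> 'v \<Rightarrow> 'v) \<Rightarrow> (usl2 \<Rightarrow> 'v \<Rightarrow> 'v) \<Rightarrow> usl2 \<Rightarrow> complex"
  where "central_character scl N = (THE \<kappa>. is_central_character scl N \<kappa>)"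

definition casimir :: usl2
  where "casimir = 2 * (usl2_gen sl2_h)^2
    + usl2_gen sl2_e12 * usl2_gen sl2_e21 + usl2_gen sl2_e21 * usl2_gen sl2_e12"

lemma sl2_decomp:
  "x = sl2_scale (2 * Rep_sl2 x $ 1 $ 1) sl2_h + sl2_scale (Rep_sl2 x $ 1 $ 2) sl2_e12
     + sl2_scale (Rep_sl2 x $ 2 $ 1) sl2_e21"
proof -
  have "Rep_sl2 x $ 1 $ 1 + Rep_sl2 x $ 2 $ 2 = 0"
    using Rep_sl2[of x] by (simp add: trace_def sum_2)
  then have "Rep_sl2 x $ 2 $ 2 = - Rep_sl2 x $ 1 $ 1"
    by (simp add: eq_neg_iff_add_eq_0 add.commute)
  then have "Rep_sl2 x = Rep_sl2 (sl2_scale (2 * Rep_sl2 x $ 1 $ 1) sl2_h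
      + sl2_scale (Rep_sl2 x $ 1 $ 2) sl2_e12 + sl2_scale (Rep_sl2 x $ 2 $ 1) sl2_e21)"
    by (simp add: plus_sl2.rep_eq sl2_scale.rep_eq vec_eq_iff forall_2 sl2_basis_entries)
  then show ?thesis by (rule Rep_sl2_inject[THEN iffD1])
qed

lemma sl2_brackets:
  "sl2_bracket sl2_h sl2_e12 = sl2_e12"
  "sl2_bracket sl2_h sl2_e21 = - sl2_e21"
  "sl2_bracket sl2_e12 sl2_e21 = sl2_h + sl2_h"
  by (simp_all add: Rep_sl2_inject[symmetric] sl2_bracket.rep_eq plus_sl2.rep_eq uminus_sl2.rep_eq
      vec_eq_iff forall_2 matrix_matrix_mult_def sum_2 sl2_basis_entries)

lemma casimir_in_center: "casimir \<in> usl2_center"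
proof -
  define H E F where "H = usl2_gen sl2_h" and "E = usl2_gen sl2_e12" and "F = usl2_gen sl2_e21"
  have neg: "usl2_gen (- x) = - usl2_gen x" for x
  proof -
    have "usl2_gen (- x) + usl2_gen x = usl2_gen 0" by (simp flip: usl2_gen_add)
    moreover have "usl2_gen 0 = 0" using usl2_gen_add[of 0 0] by simp
    ultimately show ?thesis by (simp add: eq_neg_iff_add_eq_0)
  qed
  have rel: "E + E * H = H * E" "- F + F * H = H * F" "H + H + F * E = E * F"
    using usl2_gen_bracket[of sl2_h sl2_e12] usl2_gen_bracket[of sl2_h sl2_e21]
      usl2_gen_bracket[of sl2_e12 sl2_e21]
    unfolding sl2_brackets neg usl2_gen_add H_def E_def F_def eq_diff_eq by blast+
  have HE: "H * E = E * H + E" by (simp add: add.commute flip: rel(1))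
  have HF: "H * F = F * H - F" by (simp flip: rel(2))
  have EF: "E * F = F * E + H + H" by (simp add: add_ac flip: rel(3))
  have HE': "H * (E * u) = E * (H * u) + E * u" for u
    by (metis HE distrib_right mult.assoc)
  have HF': "H * (F * u) = F * (H * u) - F * u" for u
    by (metis HF left_diff_distrib mult.assoc)
  have EF': "E * (F * u) = F * (E * u) + H * u + H * u" for u
    by (metis EF distrib_right mult.assoc)
  have cas: "casimir = H * H + H * H + E * F + F * E"
    by (simp add: casimir_def H_def E_def F_def power2_eq_square mult_2)
  note rules = HE HF EF HE' HF' EF'
  have gens: "casimir * H = H * casimir" "casimir * E = E * casimir" "casimir * F = F * casimir"
    by (simp_all add: cas rules distrib_left distrib_right right_diff_distrib
        left_diff_distrib mult.assoc)
  have "casimir * u = u * casimir" for u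
  proof (induction u rule: usl2_induct)
    case (scalar c)
    then show ?case by (simp add: usl2_scalar_central)
  next
    case (gen x)
    have scal: "casimir * (usl2_scalar c * v) = usl2_scalar c * (casimir * v)" for c v
      by (metis mult.assoc usl2_scalar_central)
    show ?case
      by (subst (1 2) sl2_decomp)
        (simp add: usl2_gen_add usl2_gen_scale distrib_left distrib_right scal mult.assoc
          gens flip: H_def E_def F_def)
  next
    case (mult u v)
    then show ?case by (metis mult.assoc)
  qed (simp add: distrib_left distrib_right)
  then show ?thesis by (simp add: usl2_center_def)
qed


section \<open>The modules on the space of complex polynomials in h\<close>

text \<open>The automorphism \<open>\<sigma>\<close> of \<open>C[h]\<close> with \<open>\<sigma>(h) = h - 1\<close> and its inverse; \<open>h\<close> is the
  polynomial variable \<open>[:0, 1:]\<close>.\<close>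

definition shift :: "complex poly \<Rightarrow> complex poly"
  where "shift f = pcompose f [:-1, 1:]"

definition shift_inv :: "complex poly \<Rightarrow> complex poly"
  where "shift_inv f = pcompose f [:1, 1:]"

lemma poly_shift: "poly (shift f) x = poly f (x - 1)" "poly (shift_inv f) x = poly f (x + 1)"
  by (simp_all add: shift_def shift_inv_def poly_pcompose add.commute)

lemma complex_poly_ext: "(\<And>x. poly f x = poly g x) \<Longrightarrow> f = (g :: complex poly)"
  by (intro iffD1[OF poly_eq_poly_eq_iff] ext)

lemma shift_shift_inv [simp]: "shift (shift_inv f) = f" "shift_inv (shift f) = f"
  by (rule complex_poly_ext; simp add: poly_shift)+

text \<open>The linear map on the Lie algebra sending the basis elements \<open>h\<close>, \<open>e\<^sub>1\<^sub>2\<close>, \<open>e\<^sub>2\<^sub>1\<close> to the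
  operators \<open>H\<close>, \<open>E\<close>, \<open>F\<close>; the coordinates are those of \<open>sl2_decomp\<close>.\<close>

definition sl2_poly_rep ::
    "(complex poly \<Rightarrow> complex poly) \<Rightarrow> (complex poly \<Rightarrow> complex poly) \<Rightarrow>
     (complex poly \<Rightarrow> complex poly) \<Rightarrow> sl2 \<Rightarrow> complex poly \<Rightarrow> complex poly"
  where "sl2_poly_rep H E F x f =
    smult (2 * Rep_sl2 x $ 1 $ 1) (H f) + smult (Rep_sl2 x $ 1 $ 2) (E f)
      + smult (Rep_sl2 x $ 2 $ 1) (F f)"

definition rho_M :: "complex \<Rightarrow> sl2 \<Rightarrow> complex poly \<Rightarrow> complex poly"
  where "rho_M b = sl2_poly_rep
    (\<lambda>f. [:0, 1:] * f)
    (\<lambda>f. [:b, 1:] * shift f)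
    (\<lambda>f. - ([:-b, 1:] * shift_inv f))"

definition rho_M' :: "complex \<Rightarrow> sl2 \<Rightarrow> complex poly \<Rightarrow> complex poly"
  where "rho_M' b = sl2_poly_rep
    (\<lambda>f. [:0, 1:] * f)
    (\<lambda>f. shift f)
    (\<lambda>f. - ([:b + 1, 1:] * [:-b, 1:] * shift_inv f))"

definition M_mod :: "complex \<Rightarrow> usl2 \<Rightarrow> complex poly \<Rightarrow> complex poly"
  where "M_mod b = usl2_act smult (rho_M b)"

definition M_mod' :: "complex \<Rightarrow> usl2 \<Rightarrow> complex poly \<Rightarrow> complex poly"
  where "M_mod' b = usl2_act smult (rho_M' b)"

lemma vector_space_smult: "vector_space (smult :: complex \<Rightarrow> complex poly \<Rightarrow> complex poly)"
  by unfold_locales (simp_all add: smult_add_right smult_add_left)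

lemma sl2_representation_poly_rep:
  assumes add: "\<And>f g. H (f + g) = H f + H g" "\<And>f g. E (f + g) = E f + E g"
      "\<And>f g. F (f + g) = F f + F g"
    and scale: "\<And>c f. H (smult c f) = smult c (H f)" "\<And>c f. E (smult c f) = smult c (E f)"
      "\<And>c f. F (smult c f) = smult c (F f)"
    and HE: "\<And>f. H (E f) = E (H f) + E f"
    and HF: "\<And>f. H (F f) = F (H f) - F f"
    and EF: "\<And>f. E (F f) = F (E f) + smult 2 (H f)"
  shows "sl2_representation smult (sl2_poly_rep H E F)"
proof -
  interpret vector_space "smult :: complex \<Rightarrow> complex poly \<Rightarrow> complex poly"
    by (rule vector_space_smult)
  show ?thesis
  proof
    fix x y :: sl2 and f g :: "complex poly" and c :: complex
    show "sl2_poly_rep H E F x (f + g) = sl2_poly_rep H E F x f + sl2_poly_rep H E F x g"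
      by (simp add: sl2_poly_rep_def add smult_add_right)
    show "sl2_poly_rep H E F x (smult c f) = smult c (sl2_poly_rep H E F x f)"
      by (simp add: sl2_poly_rep_def scale smult_add_right mult.commute)
    show "sl2_poly_rep H E F (x + y) f = sl2_poly_rep H E F x f + sl2_poly_rep H E F y f"
      by (simp add: sl2_poly_rep_def plus_sl2.rep_eq smult_add_left distrib_left)
    show "sl2_poly_rep H E F (sl2_scale c x) f = smult c (sl2_poly_rep H E F x f)"
      by (simp add: sl2_poly_rep_def sl2_scale.rep_eq smult_add_right mult_ac)
    have tr: "Rep_sl2 z $ 2 $ 2 = - Rep_sl2 z $ 1 $ 1" for z
      using Rep_sl2[of z] by (simp add: trace_def sum_2 eq_neg_iff_add_eq_0 add.commute)
    show "sl2_poly_rep H E F (sl2_bracket x y) f =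
        sl2_poly_rep H E F x (sl2_poly_rep H E F y f)
        - sl2_poly_rep H E F y (sl2_poly_rep H E F x f)"
      unfolding sl2_poly_rep_def
      by (rule poly_eqI) (simp add: add scale HE HF EF sl2_bracket.rep_eq
          matrix_matrix_mult_def sum_2 tr algebra_simps)
  qed
qed

lemma sl2_representation_M: "sl2_representation smult (rho_M b)"
  unfolding rho_M_def
  by (rule sl2_representation_poly_rep; rule complex_poly_ext)
    (simp_all add: poly_shift, simp_all add: algebra_simps)

lemma sl2_representation_M': "sl2_representation smult (rho_M' b)"
  unfolding rho_M'_def
  by (rule sl2_representation_poly_rep; rule complex_poly_ext)
    (simp_all add: poly_shift, simp_all add: algebra_simps)

lemma M_mod_actions:
  "M_mod b (usl2_gen sl2_h) f = [:0, 1:] * f"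
  "M_mod b (usl2_gen sl2_e12) f = [:b, 1:] * shift f"
  "M_mod b (usl2_gen sl2_e21) f = - ([:-b, 1:] * shift_inv f)"
  unfolding M_mod_def sl2_representation.usl2_act_gen[OF sl2_representation_M]
  by (simp_all add: rho_M_def sl2_poly_rep_def sl2_basis_entries)

lemma M_mod'_actions:
  "M_mod' b (usl2_gen sl2_h) f = [:0, 1:] * f"
  "M_mod' b (usl2_gen sl2_e12) f = shift f"
  "M_mod' b (usl2_gen sl2_e21) f = - ([:b + 1, 1:] * [:-b, 1:] * shift_inv f)"
  unfolding M_mod'_def sl2_representation.usl2_act_gen[OF sl2_representation_M']
  by (simp_all add: rho_M'_def sl2_poly_rep_def sl2_basis_entries)

lemma usl2_module_M_mod: "usl2_module smult (M_mod b)" and usl2_module_M_mod': "usl2_module smult (M_mod' b)"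
  unfolding M_mod_def M_mod'_def
  by (intro sl2_representation.usl2_module_act sl2_representation_M sl2_representation_M')+

end

theory Submission
  imports Defs
begin

text \<open>
  An operator on \<open>C[h]\<close> commuting with \<open>h\<close> is multiplication by a polynomial, and commuting with
  \<open>e\<^sub>1\<^sub>2\<close> makes this polynomial invariant under \<open>\<sigma>\<close>, hence constant: central elements act as
  scalars. The twists fix \<open>c\<^sub>2\<close>, so its eigenvalue can be computed on the untwisted modules.

  That a character of the center is determined by its value at \<open>c\<^sub>2\<close> needs that the center is
  \<open>C[c\<^sub>2]\<close>. Since \<open>e\<^sub>1\<^sub>2 e\<^sub>2\<^sub>1\<close> and \<open>e\<^sub>2\<^sub>1 e\<^sub>1\<^sub>2\<close> lie in \<open>C[c\<^sub>2, h]\<close>, the enveloping algebra is the sum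
  of the spaces \<open>C[c\<^sub>2, h] e\<^sub>1\<^sub>2\<^sup>k\<close> and \<open>C[c\<^sub>2, h] e\<^sub>2\<^sub>1\<^sup>k\<close>, on which \<open>ad h\<close> acts by \<open>k\<close> and \<open>-k\<close>; a
  central element therefore lies in \<open>C[c\<^sub>2, h]\<close>. Such an element \<open>p(c\<^sub>2, h)\<close> acts on \<open>M\<^sub>b'\<close> as
  multiplication by \<open>p(2b(b+1), h)\<close>, which must be constant in \<open>h\<close> for every \<open>b\<close>, so \<open>p\<close> does not
  involve \<open>h\<close>. Letting \<open>b\<close> vary replaces the linear independence part of the PBW theorem.
\<close>

section \<open>Commutation relations\<close>

abbreviation "H \<equiv> usl2_gen sl2_h"
abbreviation "E \<equiv> usl2_gen sl2_e12"
abbreviation "F \<equiv> usl2_gen sl2_e21"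

lemma usl2_scalar_uminus: "usl2_scalar (- c) = - usl2_scalar c"
  by (metis mult_minus1 usl2_scalar_mult usl2_uminus)

lemma usl2_gen_uminus: "usl2_gen (- x) = - usl2_gen x"
proof -
  have "usl2_gen (- x) + usl2_gen x = usl2_gen 0"
    by (simp flip: usl2_gen_add)
  moreover have "usl2_gen 0 = 0"
    using usl2_gen_add[of 0 0] by simp
  ultimately show ?thesis
    by (simp add: eq_neg_iff_add_eq_0)
qed

lemma E_mult_H: "E * H = (H - 1) * E"
  using usl2_gen_bracket[of sl2_h sl2_e12] by (simp add: sl2_brackets algebra_simps)

lemma F_mult_H: "F * H = (H + 1) * F"
  using usl2_gen_bracket[of sl2_h sl2_e21]
  by (simp add: sl2_brackets usl2_gen_uminus algebra_simps)

lemma commutator_E_F: "E * F = F * E + H + H"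
  using usl2_gen_bracket[of sl2_e12 sl2_e21]
  by (simp add: sl2_brackets usl2_gen_add algebra_simps)

lemma casimir_commute: "casimir * u = u * casimir"
  using casimir_in_center by (simp add: usl2_center_def)

text \<open>The enveloping algebra is declared only as a ring, so division by 2 is multiplication by
  the image of the scalar \<open>1 / 2\<close>.\<close>

lemma usl2_half: "usl2_scalar (1 / 2) * (u + u) = u"
  by (simp add: distrib_left) (simp flip: distrib_right usl2_scalar_add)

text \<open>Solves \<open>c_2 = 2 h^2 + E F + F E\<close> and \<open>E F - F E = 2 h\<close> for
  \<open>E F\<close>; solving for \<open>F E\<close> instead gives the next lemma.\<close>

lemma E_mult_F_casimir: "E * F = usl2_scalar (1 / 2) * (casimir - (H * H + H * H) + (H + H))"
proof -
  have "casimir - (H * H + H * H) + (H + H) = E * F + E * F"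
    by (simp add: casimir_def commutator_E_F power2_eq_square mult_2 algebra_simps)
  then show ?thesis
    by (simp add: usl2_half)
qed

lemma F_mult_E_casimir: "F * E = usl2_scalar (1 / 2) * (casimir - (H * H + H * H) - (H + H))"
proof -
  have "casimir - (H * H + H * H) - (H + H) = F * E + F * E"
    by (simp add: casimir_def commutator_E_F power2_eq_square mult_2 algebra_simps)
  then show ?thesis
    by (simp add: usl2_half)
qed

lemma H_mult_E_power: "H * E ^ k = E ^ k * H + usl2_scalar (of_nat k) * E ^ k"
proof (induction k)
  case (Suc k)
  have "H * E ^ Suc k = (E * H + E) * E ^ k"
    by (simp add: E_mult_H algebra_simps)
  also have "\<dots> = E * (H * E ^ k) + E ^ Suc k"
    by (simp add: algebra_simps)
  also have "\<dots> = E ^ Suc k * H + usl2_scalar (of_nat k) * E ^ Suc k + E ^ Suc k"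
    unfolding Suc by (simp add: distrib_left mult.assoc)
      (metis mult.assoc usl2_scalar_central)
  finally show ?case
    by (simp add: usl2_scalar_add algebra_simps)
qed simp

lemma H_mult_F_power: "H * F ^ k = F ^ k * H + usl2_scalar (- of_nat k) * F ^ k"
proof (induction k)
  case (Suc k)
  have scalar: "usl2_scalar (- of_nat (Suc k)) = usl2_scalar (- of_nat k) - 1"
    unfolding of_nat_Suc usl2_scalar_uminus usl2_scalar_add usl2_scalar_1 by simp
  have "H * F ^ Suc k = (F * H - F) * F ^ k"
    by (simp add: F_mult_H algebra_simps)
  also have "\<dots> = F * (H * F ^ k) - F ^ Suc k"
    by (simp add: algebra_simps)
  also have "\<dots> = F ^ Suc k * H + usl2_scalar (- of_nat k) * F ^ Suc k - F ^ Suc k"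
    unfolding Suc by (simp add: distrib_left mult.assoc)
      (metis mult.assoc usl2_scalar_central)
  finally show ?case
    unfolding scalar by (simp add: algebra_simps)
qed simp


section \<open>The center of the enveloping algebra\<close>

text \<open>Horner evaluation at \<open>c_2\<close>, with the complex coefficients embedded by
  \<open>usl2_scalar\<close> into a noncommutative ring.\<close>

definition casimir_poly :: "complex poly \<Rightarrow> usl2"
  where "casimir_poly p = fold_coeffs (\<lambda>c u. usl2_scalar c + casimir * u) p 0"

lemma casimir_poly_0 [simp]: "casimir_poly 0 = 0"
  by (simp add: casimir_poly_def)

lemma casimir_poly_pCons [simp]:
  "casimir_poly (pCons c p) = usl2_scalar c + casimir * casimir_poly p"
  by (cases "c = 0 \<and> p = 0") (auto simp: casimir_poly_def)

lemma casimir_poly_add: "casimir_poly (p + q) = casimir_poly p + casimir_poly q"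
  by (induction p q rule: poly_induct2) (simp_all add: usl2_scalar_add algebra_simps)

lemma casimir_poly_in_center: "casimir_poly p \<in> usl2_center"
proof -
  have "casimir_poly p * u = u * casimir_poly p" for u
  proof (induction p)
    case (pCons c p)
    have "casimir * casimir_poly p * u = u * (casimir * casimir_poly p)"
      by (metis casimir_commute mult.assoc pCons.IH)
    then show ?case
      by (simp add: distrib_left distrib_right usl2_scalar_central)
  qed simp
  then show ?thesis by (simp add: usl2_center_def)
qed

lemma casimir_poly_commute: "casimir_poly p * u = u * casimir_poly p"
  using casimir_poly_in_center[of p] by (simp add: usl2_center_def)

text \<open>Evaluation of \<open>C[x][y]\<close> at \<open>x = c\<^sub>2\<close> and \<open>y = h\<close>.\<close>

definition casimir_H_poly :: "complex poly poly \<Rightarrow> usl2"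
  where "casimir_H_poly P = fold_coeffs (\<lambda>p u. casimir_poly p + u * H) P 0"

lemma casimir_H_poly_0 [simp]: "casimir_H_poly 0 = 0"
  by (simp add: casimir_H_poly_def)

lemma casimir_H_poly_pCons [simp]:
  "casimir_H_poly (pCons p P) = casimir_poly p + casimir_H_poly P * H"
  by (cases "p = 0 \<and> P = 0") (auto simp: casimir_H_poly_def)

lemma casimir_H_poly_add: "casimir_H_poly (P + Q) = casimir_H_poly P + casimir_H_poly Q"
  by (induction P Q rule: poly_induct2) (simp_all add: casimir_poly_add algebra_simps)

lemma H_casimir_H_poly_commute: "H * casimir_H_poly P = casimir_H_poly P * H"
  by (induction P)
    (simp_all add: distrib_left distrib_right casimir_poly_commute flip: mult.assoc)

section \<open>The subalgebra generated by \<open>c_2\<close> and \<open>h\<close>\<close>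

definition casimir_H_alg :: "usl2 set"
  where "casimir_H_alg = range casimir_H_poly"

lemma casimir_H_alg_add: "u \<in> casimir_H_alg \<Longrightarrow> v \<in> casimir_H_alg \<Longrightarrow> u + v \<in> casimir_H_alg"
  unfolding casimir_H_alg_def by (auto simp flip: casimir_H_poly_add)

lemma casimir_H_alg_mult_H: "u \<in> casimir_H_alg \<Longrightarrow> u * H \<in> casimir_H_alg"
  unfolding casimir_H_alg_def
  by (metis add_0 casimir_H_poly_pCons casimir_poly_0 rangeE rangeI)

lemma casimir_poly_in_casimir_H_alg: "casimir_poly p \<in> casimir_H_alg"
  unfolding casimir_H_alg_def
  by (metis add_0_right casimir_H_poly_0 casimir_H_poly_pCons mult_zero_left rangeI)

lemma H_commute_casimir_H_alg: "u \<in> casimir_H_alg \<Longrightarrow> H * u = u * H"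
  unfolding casimir_H_alg_def by (auto simp: H_casimir_H_poly_commute)

lemma casimir_H_alg_scalar: "usl2_scalar c \<in> casimir_H_alg"
  using casimir_poly_in_casimir_H_alg[of "[:c:]"] by simp

lemma casimir_H_alg_casimir: "casimir \<in> casimir_H_alg"
  using casimir_poly_in_casimir_H_alg[of "[:0, 1:]"] by simp

text \<open>Horner's scheme as an induction rule: closure properties can be proved without handling
  bivariate polynomials.\<close>

lemma casimir_H_alg_induct [consumes 1, case_names zero step]:
  assumes "u \<in> casimir_H_alg" "Q 0" "\<And>p u. u \<in> casimir_H_alg \<Longrightarrow> Q u \<Longrightarrow> Q (casimir_poly p + u * H)"
  shows "Q u"
proof -
  have "Q (casimir_H_poly P)" for P
    by (induction P) (use assms(2,3) in \<open>auto simp: casimir_H_alg_def\<close>)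
  with assms(1) show ?thesis by (auto simp: casimir_H_alg_def)
qed

text \<open>First half of closure under products. In Horner form
  \<open>p (q + u h) = p q + (p u) h\<close>, so everything reduces to products inside
  \<open>C[c_2]\<close>, the local fact \<open>mult\<close>.\<close>

lemma casimir_poly_mult_casimir_H_alg:
  assumes "u \<in> casimir_H_alg"
  shows "casimir_poly p * u \<in> casimir_H_alg"
proof -
  have mult: "casimir_poly p * casimir_poly q = casimir_poly (p * q)" for p q
  proof (induction p)
    case (pCons c p)
    have "usl2_scalar c * casimir_poly q = casimir_poly (smult c q)"
      by (induction q)
        (simp_all add: distrib_left usl2_scalar_mult, metis mult.assoc usl2_scalar_central)
    with pCons show ?case
      by (simp add: casimir_poly_add distrib_right mult.assoc)
  qed simp
  show ?thesis
    using assms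
  proof (induction rule: casimir_H_alg_induct)
    case zero
    then show ?case using casimir_poly_in_casimir_H_alg[of 0] by simp
  next
    case (step q u)
    then show ?case
      by (simp add: distrib_left mult casimir_H_alg_add casimir_H_alg_mult_H
          casimir_poly_in_casimir_H_alg flip: mult.assoc)
  qed
qed

lemma casimir_H_alg_mult:
  assumes "u \<in> casimir_H_alg" "v \<in> casimir_H_alg"
  shows "u * v \<in> casimir_H_alg"
  using assms(2)
proof (induction rule: casimir_H_alg_induct)
  case zero
  then show ?case using casimir_poly_in_casimir_H_alg[of 0] by simp
next
  case (step p v)
  then show ?case
    using assms(1)
    by (simp add: distrib_left casimir_H_alg_add casimir_H_alg_mult_H
        casimir_poly_mult_casimir_H_alg flip: casimir_poly_commute mult.assoc)
qed

lemma casimir_H_alg_H: "H \<in> casimir_H_alg"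
  using casimir_H_alg_mult_H[OF casimir_H_alg_scalar[of 1]] by simp

lemma casimir_H_alg_uminus: "u \<in> casimir_H_alg \<Longrightarrow> - u \<in> casimir_H_alg"
  unfolding usl2_uminus by (intro casimir_H_alg_mult casimir_H_alg_scalar)

lemma casimir_H_alg_diff:
  "u \<in> casimir_H_alg \<Longrightarrow> v \<in> casimir_H_alg \<Longrightarrow> u - v \<in> casimir_H_alg"
  unfolding minus_usl2_def by (intro casimir_H_alg_add casimir_H_alg_uminus)

lemma E_mult_F_in_casimir_H_alg: "E * F \<in> casimir_H_alg"
  unfolding E_mult_F_casimir
  by (intro casimir_H_alg_mult casimir_H_alg_add casimir_H_alg_diff casimir_H_alg_scalar
      casimir_H_alg_casimir casimir_H_alg_H)

lemma F_mult_E_in_casimir_H_alg: "F * E \<in> casimir_H_alg"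
  unfolding F_mult_E_casimir
  by (intro casimir_H_alg_mult casimir_H_alg_add casimir_H_alg_diff casimir_H_alg_scalar
      casimir_H_alg_casimir casimir_H_alg_H)

text \<open>Moving \<open>x\<close> to the right past \<open>p(c_2, h)\<close> replaces
  \<open>h\<close> by \<open>H'\<close>. This is applied to \<open>E\<close> with
  \<open>H - 1\<close> and to \<open>F\<close> with \<open>H + 1\<close>.\<close>

lemma casimir_H_alg_twisted_commute:
  assumes "u \<in> casimir_H_alg" "x * H = H' * x" "H' \<in> casimir_H_alg"
  shows "\<exists>v\<in>casimir_H_alg. x * u = v * x"
  using assms(1)
proof (induction rule: casimir_H_alg_induct)
  case zero
  then show ?case using casimir_H_alg_scalar[of 0] by (intro bexI[of _ 0]) simp_all
next
  case (step p u)
  then obtain v where v: "v \<in> casimir_H_alg" "x * u = v * x" by blast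
  have "x * (casimir_poly p + u * H) = (casimir_poly p + v * H') * x"
    by (simp add: distrib_left distrib_right casimir_poly_commute v(2) mult.assoc
        flip: assms(2)) (metis mult.assoc v(2))
  moreover have "casimir_poly p + v * H' \<in> casimir_H_alg"
    using v(1) assms(3)
    by (intro casimir_H_alg_add casimir_H_alg_mult casimir_poly_in_casimir_H_alg)
  ultimately show ?case by blast
qed

lemma E_mult_casimir_H_alg: "u \<in> casimir_H_alg \<Longrightarrow> \<exists>v\<in>casimir_H_alg. E * u = v * E"
  using casimir_H_alg_scalar[of 1]
  by (intro casimir_H_alg_twisted_commute[OF _ E_mult_H])
    (simp_all add: casimir_H_alg_diff casimir_H_alg_H)

lemma F_mult_casimir_H_alg: "u \<in> casimir_H_alg \<Longrightarrow> \<exists>v\<in>casimir_H_alg. F * u = v * F"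
  using casimir_H_alg_scalar[of 1]
  by (intro casimir_H_alg_twisted_commute[OF _ F_mult_H])
    (simp_all add: casimir_H_alg_add casimir_H_alg_H)

section \<open>Weight vectors for the adjoint action of \<open>h\<close>\<close>

inductive_set weight_span :: "usl2 set" where
  E_power: "u \<in> casimir_H_alg \<Longrightarrow> u * E ^ k \<in> weight_span"
| F_power: "u \<in> casimir_H_alg \<Longrightarrow> u * F ^ k \<in> weight_span"
| add: "u \<in> weight_span \<Longrightarrow> v \<in> weight_span \<Longrightarrow> u + v \<in> weight_span"

lemma casimir_H_alg_mult_weight_span:
  assumes "v \<in> weight_span" "u \<in> casimir_H_alg"
  shows "u * v \<in> weight_span"
  using assms
  by (induction rule: weight_span.induct)
    (simp_all add: casimir_H_alg_mult distrib_left weight_span.intros flip: mult.assoc)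

text \<open>On \<open>u * F ^ Suc l\<close> the new \<open>E\<close> meets one \<open>F\<close>
  after passing \<open>u\<close>, and \<open>E * F\<close> is absorbed into the coefficient. For
  \<open>k = 0\<close> there is no \<open>F\<close> to meet, and the result is a multiple of
  \<open>E ^ 1\<close>.\<close>

lemma E_mult_weight_span: "v \<in> weight_span \<Longrightarrow> E * v \<in> weight_span"
proof (induction rule: weight_span.induct)
  case (E_power u k)
  then obtain w where "w \<in> casimir_H_alg" "E * u = w * E"
    using E_mult_casimir_H_alg by blast
  moreover from this have "E * (u * E ^ k) = w * E ^ Suc k"
    by (metis mult.assoc power_Suc)
  ultimately show ?case using weight_span.E_power by metis
next
  case (F_power u k)
  then obtain w where w: "w \<in> casimir_H_alg" "E * u = w * E"
    using E_mult_casimir_H_alg by blast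
  show ?case
  proof (cases k)
    case 0
    with w weight_span.E_power[OF w(1), of 1] show ?thesis by simp
  next
    case (Suc l)
    have "E * (u * F ^ k) = (w * (E * F)) * F ^ l"
      unfolding Suc by (metis w(2) mult.assoc power_Suc)
    then show ?thesis
      using weight_span.F_power casimir_H_alg_mult[OF w(1) E_mult_F_in_casimir_H_alg] by metis
  qed
next
  case (add u v)
  then show ?case by (simp add: distrib_left weight_span.add)
qed

lemma F_mult_weight_span: "v \<in> weight_span \<Longrightarrow> F * v \<in> weight_span"
proof (induction rule: weight_span.induct)
  case (F_power u k)
  then obtain w where "w \<in> casimir_H_alg" "F * u = w * F"
    using F_mult_casimir_H_alg by blast
  moreover from this have "F * (u * F ^ k) = w * F ^ Suc k"
    by (metis mult.assoc power_Suc)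
  ultimately show ?case using weight_span.F_power by metis
next
  case (E_power u k)
  then obtain w where w: "w \<in> casimir_H_alg" "F * u = w * F"
    using F_mult_casimir_H_alg by blast
  show ?case
  proof (cases k)
    case 0
    with w weight_span.F_power[OF w(1), of 1] show ?thesis by simp
  next
    case (Suc l)
    have "F * (u * E ^ k) = (w * (F * E)) * E ^ l"
      unfolding Suc by (metis w(2) mult.assoc power_Suc)
    then show ?thesis
      using weight_span.E_power casimir_H_alg_mult[OF w(1) F_mult_E_in_casimir_H_alg] by metis
  qed
next
  case (add u v)
  then show ?case by (simp add: distrib_left weight_span.add)
qed

text \<open>The span contains 1 and is stable under left multiplication by scalars and generators,
  hence by every \<open>u\<close>. Keeping \<open>v\<close> arbitrary turns the product case into
  two successive multiplications.\<close>

lemma weight_span_UNIV: "u \<in> weight_span"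
proof -
  have "u * v \<in> weight_span" if "v \<in> weight_span" for v
    using that
  proof (induction u arbitrary: v rule: usl2_induct)
    case (scalar c)
    then show ?case by (simp add: casimir_H_alg_mult_weight_span casimir_H_alg_scalar)
  next
    case (gen x)
    then show ?case
      by (subst sl2_decomp)
        (simp add: usl2_gen_add usl2_gen_scale distrib_right mult.assoc weight_span.add
          casimir_H_alg_mult_weight_span casimir_H_alg_scalar casimir_H_alg_H
          E_mult_weight_span F_mult_weight_span)
  next
    case (add u w)
    then show ?case by (simp add: distrib_right weight_span.add)
  next
    case (mult u w)
    then show ?case by (simp add: mult.assoc)
  qed
  moreover have "1 \<in> weight_span"
    using weight_span.E_power[OF casimir_H_alg_scalar[of 1], of 0] by simp
  ultimately show ?thesis by (metis mult_1_right)
qed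

text \<open>The vector 0 qualifies, with any \<open>k\<close>. This matters when a summand is
  annihilated in \<open>sum_nonzero_weights_eq_0\<close>.\<close>

definition nonzero_weight :: "usl2 \<Rightarrow> bool"
  where "nonzero_weight w \<longleftrightarrow> (\<exists>k. k \<noteq> 0 \<and> H * w - w * H = usl2_scalar k * w)"

lemma nonzero_weight_E_power:
  assumes "u \<in> casimir_H_alg"
  shows "nonzero_weight (u * E ^ Suc k)"
  unfolding nonzero_weight_def
proof (intro exI conjI)
  have "H * (u * E ^ Suc k) = u * (H * E ^ Suc k)"
    by (metis H_commute_casimir_H_alg[OF assms] mult.assoc)
  then show "H * (u * E ^ Suc k) - u * E ^ Suc k * H
      = usl2_scalar (of_nat (Suc k)) * (u * E ^ Suc k)"
    unfolding H_mult_E_power distrib_left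
    by (metis add_diff_cancel_left' mult.assoc usl2_scalar_central)
qed (simp del: of_nat_Suc)

lemma nonzero_weight_F_power:
  assumes "u \<in> casimir_H_alg"
  shows "nonzero_weight (u * F ^ Suc k)"
  unfolding nonzero_weight_def
proof (intro exI conjI)
  have "H * (u * F ^ Suc k) = u * (H * F ^ Suc k)"
    by (metis H_commute_casimir_H_alg[OF assms] mult.assoc)
  then show "H * (u * F ^ Suc k) - u * F ^ Suc k * H
      = usl2_scalar (- of_nat (Suc k)) * (u * F ^ Suc k)"
    unfolding H_mult_F_power distrib_left
    by (metis add_diff_cancel_left' mult.assoc usl2_scalar_central)
qed (simp del: of_nat_Suc)

text \<open>Terms with exponent 0 go into \<open>v\<close>, all others into \<open>ws\<close>.
  Weights may repeat in \<open>ws\<close>, and no linear independence is claimed.\<close>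

lemma weight_decomposition:
  "\<exists>v\<in>casimir_H_alg. \<exists>ws. list_all nonzero_weight ws \<and> u = v + sum_list ws"
  using weight_span_UNIV[of u]
proof (induction rule: weight_span.induct)
  case (E_power u k)
  show ?case
  proof (cases k)
    case 0
    with E_power show ?thesis by (intro bexI[of _ u] exI[of _ "[]"]) simp_all
  next
    case (Suc l)
    with E_power show ?thesis
      using nonzero_weight_E_power[of u l] casimir_H_alg_scalar[of 0]
      by (intro bexI[of _ 0] exI[of _ "[u * E ^ k]"]) simp_all
  qed
next
  case (F_power u k)
  show ?case
  proof (cases k)
    case 0
    with F_power show ?thesis by (intro bexI[of _ u] exI[of _ "[]"]) simp_all
  next
    case (Suc l)
    with F_power show ?thesis
      using nonzero_weight_F_power[of u l] casimir_H_alg_scalar[of 0]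
      by (intro bexI[of _ 0] exI[of _ "[u * F ^ k]"]) simp_all
  qed
next
  case (add u u')
  then obtain v ws v' ws' where
    "v \<in> casimir_H_alg" "list_all nonzero_weight ws" "u = v + sum_list ws"
    "v' \<in> casimir_H_alg" "list_all nonzero_weight ws'" "u' = v' + sum_list ws'"
    by blast
  then show ?case
    by (intro bexI[of _ "v + v'"] exI[of _ "ws @ ws'"])
      (simp_all add: casimir_H_alg_add add_ac)
qed

text \<open>Let \<open>k\<close> be the weight of the first summand. The operator \<open>T\<close>,
  which is ad \<open>h\<close> minus \<open>k\<close>, kills that summand and preserves the weights
  of the others. Since \<open>s\<close> commutes with \<open>h\<close>, also
  \<open>T s = - k s\<close>; so \<open>T s\<close> is a shorter sum commuting with
  \<open>h\<close>, which vanishes by induction, and \<open>k\<close> is nonzero.\<close>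

lemma sum_nonzero_weights_eq_0:
  assumes "list_all nonzero_weight ws" "H * sum_list ws = sum_list ws * H"
  shows "sum_list ws = 0"
  using assms
\<comment> \<open>The induction runs over the length because its hypothesis is applied to
  \<open>map T xs\<close>, not to the tail \<open>xs\<close>.\<close>
proof (induction "length ws" arbitrary: ws)
  case (Suc n)
  then obtain x xs where ws: "ws = x # xs" and len: "length xs = n"
    by (metis Suc_length_conv)
  define s where "s = sum_list ws"
  from Suc.prems(1) obtain k where k: "k \<noteq> 0" "H * x - x * H = usl2_scalar k * x"
    by (auto simp: ws nonzero_weight_def)
  define T where "T w = H * w - w * H - usl2_scalar k * w" for w
  have T_add: "T (v + w) = T v + T w" for v w
    by (simp add: T_def algebra_simps)
  have T_sum: "T (sum_list vs) = sum_list (map T vs)" for vs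
    by (induction vs) (simp_all add: T_add, simp add: T_def)
  have T_weight: "nonzero_weight (T w)" if w: "nonzero_weight w" for w
  proof -
    from w obtain l where l: "l \<noteq> 0" "H * w - w * H = usl2_scalar l * w"
      by (auto simp: nonzero_weight_def)
    have "T w = usl2_scalar (l - k) * w"
      using usl2_scalar_add[of l "- k"]
      by (simp add: T_def l(2) usl2_scalar_uminus left_diff_distrib)
    moreover have "H * (usl2_scalar (l - k) * w) - usl2_scalar (l - k) * w * H
        = usl2_scalar (l - k) * (H * w - w * H)"
      by (simp add: right_diff_distrib mult.assoc)
        (metis mult.assoc usl2_scalar_central)
    ultimately show ?thesis
      unfolding nonzero_weight_def using l by (metis mult.assoc usl2_scalar_central)
  qed
  have T_s: "T s = - (usl2_scalar k * s)"
    using Suc.prems(2) by (simp add: T_def s_def)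
  have s_eq: "T s = sum_list (map T xs)"
    using k(2) by (simp add: s_def ws T_add T_sum) (simp add: T_def)
  have "H * T s = T s * H"
    unfolding T_s using Suc.prems(2)
    by (simp flip: s_def) (metis mult.assoc usl2_scalar_central)
  then have "T s = 0"
    unfolding s_eq using Suc.prems(1) len
    by (intro Suc.hyps(1)) (auto simp: ws list_all_iff T_weight)
  then have "usl2_scalar (inverse k) * (usl2_scalar k * s) = 0"
    by (simp add: T_s)
  then show ?case
    using k(1) by (simp add: s_def flip: mult.assoc usl2_scalar_mult)
qed simp

text \<open>Both \<open>z\<close> and its weight 0 part \<open>v\<close> commute with
  \<open>h\<close>, hence so does the remainder \<open>sum_list ws\<close>, which must then
  vanish.\<close>

lemma usl2_center_subset_casimir_H_alg: "usl2_center \<subseteq> casimir_H_alg"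
proof
  fix z assume z: "z \<in> usl2_center"
  obtain v ws where vws: "v \<in> casimir_H_alg" "list_all nonzero_weight ws" "z = v + sum_list ws"
    using weight_decomposition by blast
  have "H * z = z * H"
    using z by (simp add: usl2_center_def)
  then have "H * sum_list ws = sum_list ws * H"
    by (simp add: vws(3) distrib_left distrib_right H_commute_casimir_H_alg[OF vws(1)])
  then show "z \<in> casimir_H_alg"
    using sum_nonzero_weights_eq_0[OF vws(2)] vws by simp
qed


section \<open>The action of the center\<close>

text \<open>Invariance gives \<open>p\<close> the value \<open>poly p 0\<close> at all natural
  numbers, and a nonzero polynomial has only finitely many roots.\<close>

lemma shift_fixed_imp_const:
  assumes "shift p = p"
  shows "p = [:poly p 0:]"
proof -
  have step: "poly p (x - 1) = poly p x" for x
    by (metis assms poly_shift(1))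
  have "poly p (of_nat n) = poly p 0" for n
    by (induction n) (use step[of "of_nat (Suc n)" for n] in \<open>simp_all\<close>)
  then have "range (of_nat :: nat \<Rightarrow> complex) \<subseteq> {x. poly (p - [:poly p 0:]) x = 0}"
    by auto
  moreover have "infinite (range (of_nat :: nat \<Rightarrow> complex))"
    by (simp add: finite_image_iff inj_of_nat)
  ultimately have "p - [:poly p 0:] = 0"
    using finite_subset poly_roots_finite by blast
  then show ?thesis by simp
qed

text \<open>The multiplier is \<open>N z 1\<close>, because 1 generates \<open>C[h]\<close> under
  \<open>h\<close>. The factor \<open>q\<close> covers both families: it is \<open>h + b\<close> for
  \<open>M_mod\<close> and 1 for \<open>M_mod'\<close>.\<close>

lemma center_acts_by_scalar:
  assumes "usl2_module smult N" "z \<in> usl2_center"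
    and NH: "\<And>f. N H f = [:0, 1:] * f"
    and NE: "\<And>f. N E f = q * shift f" and "q \<noteq> 0"
  shows "\<exists>c. \<forall>f. N z f = smult c f"
proof -
  interpret usl2_module smult N by fact
  have comm: "N z (N u f) = N u (N z f)" for u f
    using assms(2) by (simp add: usl2_center_def flip: act_mult)
  have smult: "N z (smult c f) = smult c (N z f)" for c f
    using comm[of "usl2_scalar c"] by (simp add: act_scalar)
  have mult: "N z f = f * N z 1" for f
  proof (induction f)
    case 0
    then show ?case using smult[of 0 0] by simp
  next
    case (pCons c f)
    have "pCons c f = smult c 1 + N H f"
      by (simp add: NH)
    then show ?case
      by (simp only: act_add_right smult comm) (simp add: NH pCons algebra_simps)
  qed
  have "q * shift (N z 1) = q * N z 1"
  proof -
    have "shift 1 = 1" by (rule complex_poly_ext) (simp add: poly_shift)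
    \<comment> \<open>The left side is \<open>N E (N z 1) = N z (N E 1)\<close>, and
      \<open>N E 1 = q\<close>.\<close>
    then show ?thesis using comm[of E 1] mult[of q] by (auto simp: NE)
  qed
  then have "N z 1 = [:poly (N z 1) 0:]"
    using \<open>q \<noteq> 0\<close> by (intro shift_fixed_imp_const) simp
  then have "N z f = smult (poly (N z 1) 0) f" for f
    using mult[of f] by (metis mult.commute mult_pCons_left mult_zero_left add_0_right pCons_0_0)
  then show ?thesis by blast
qed

lemma center_acts_by_scalar_M_mod: "z \<in> usl2_center \<Longrightarrow> \<exists>c. \<forall>f. M_mod b z f = smult c f"
  by (rule center_acts_by_scalar[OF usl2_module_M_mod _ M_mod_actions(1,2)]) simp_all

lemma center_acts_by_scalar_M_mod': "z \<in> usl2_center \<Longrightarrow> \<exists>c. \<forall>f. M_mod' b z f = smult c f"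
  by (rule center_acts_by_scalar[OF usl2_module_M_mod', where q = 1])
    (simp_all add: M_mod'_actions)

text \<open>The shifts cancel in \<open>E F\<close> and \<open>F E\<close>, leaving multiplication
  by \<open>2 h^2 - (h + b)(h - 1 - b) - (h - b)(h + 1 + b)\<close>, which is free of
  \<open>h\<close>. The same products occur for \<open>M_mod'\<close>.\<close>

lemma casimir_acts_M_mod: "M_mod b casimir f = smult (2 * b * (b + 1)) f"
proof -
  interpret usl2_module smult "M_mod b" by (rule usl2_module_M_mod)
  have "M_mod b casimir f = M_mod b H (M_mod b H f) + M_mod b H (M_mod b H f)
      + M_mod b E (M_mod b F f) + M_mod b F (M_mod b E f)"
    unfolding casimir_def power2_eq_square mult_2 act_add act_mult ..
  also have "\<dots> = smult (2 * b * (b + 1)) f"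
    unfolding M_mod_actions
    by (rule complex_poly_ext) (simp add: poly_shift, simp add: algebra_simps)
  finally show ?thesis .
qed

lemma casimir_acts_M_mod': "M_mod' b casimir f = smult (2 * b * (b + 1)) f"
proof -
  interpret usl2_module smult "M_mod' b" by (rule usl2_module_M_mod')
  have "M_mod' b casimir f = M_mod' b H (M_mod' b H f) + M_mod' b H (M_mod' b H f)
      + M_mod' b E (M_mod' b F f) + M_mod' b F (M_mod' b E f)"
    unfolding casimir_def power2_eq_square mult_2 act_add act_mult ..
  also have "\<dots> = smult (2 * b * (b + 1)) f"
    unfolding M_mod'_actions
    by (rule complex_poly_ext) (simp add: poly_shift, simp add: algebra_simps)
  finally show ?thesis .
qed

text \<open>The eigenvalue of \<open>c_2\<close> is substituted in each coefficient, while the outer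
  variable remains as \<open>h\<close>. For a central element this multiplier has to be
  constant.\<close>

lemma casimir_H_poly_acts_M_mod':
  "M_mod' b (casimir_H_poly P) f = map_poly (\<lambda>p. poly p (2 * b * (b + 1))) P * f"
proof -
  interpret usl2_module smult "M_mod' b" by (rule usl2_module_M_mod')
  define m where "m = 2 * b * (b + 1)"
  have zero: "M_mod' b 0 f = 0" for f
    using act_scalar[of 0 f] by simp
  have m: "M_mod' b casimir f = smult m f" for f
    by (simp only: casimir_acts_M_mod' m_def)
  have cas: "M_mod' b (casimir_poly p) f = smult (poly p m) f" for p f
    by (induction p arbitrary: f)
      (simp_all add: zero act_add act_mult act_scalar m smult_add_left)
  have "M_mod' b (casimir_H_poly P) f = map_poly (\<lambda>p. poly p m) P * f"
    by (induction P arbitrary: f)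
      (simp_all add: zero act_add act_mult cas M_mod'_actions map_poly_pCons)
  then show ?thesis by (simp add: m_def)
qed

lemma usl2_center_eq: "usl2_center = range casimir_poly"
proof
  show "range casimir_poly \<subseteq> usl2_center"
    by (auto simp: casimir_poly_in_center)
next
  show "usl2_center \<subseteq> range casimir_poly"
  proof
    fix z assume z: "z \<in> usl2_center"
    then obtain P where P: "z = casimir_H_poly P"
      using usl2_center_subset_casimir_H_alg by (auto simp: casimir_H_alg_def)
    have "coeff P j = 0" if j: "j > 0" for j
    proof (rule complex_poly_ext)
      fix x
      \<comment> \<open>A solution of \<open>2 * b * (b + 1) = x\<close>: every complex
        \<open>x\<close> is the eigenvalue of \<open>c_2\<close> on some \<open>M_mod' b\<close>, so
        the coefficient, a polynomial in \<open>c_2\<close>, vanishes everywhere.\<close>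
      define b where "b = (csqrt (1 + 2 * x) - 1) / 2"
      have "2 * b * (b + 1) = (csqrt (1 + 2 * x) ^ 2 - 1) / 2"
        unfolding b_def by (simp add: field_simps power2_eq_square)
      then have b: "2 * b * (b + 1) = x"
        by simp
      obtain c where "M_mod' b z 1 = smult c 1"
        using center_acts_by_scalar_M_mod'[OF z] by blast
      then have "map_poly (\<lambda>p. poly p x) P = [:c:]"
        using casimir_H_poly_acts_M_mod'[of b P 1] by (simp add: P b)
      then have "coeff (map_poly (\<lambda>p. poly p x) P) j = 0"
        using j by (simp add: coeff_pCons split: nat.split)
      then show "poly (coeff P j) x = poly 0 x"
        by (simp add: coeff_map_poly)
    qed
    then have "P = [:coeff P 0:]"
      by (intro poly_eqI) (simp add: coeff_pCons split: nat.split)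
    then have "z = casimir_poly (coeff P 0)"
      by (metis P add_0_right casimir_H_poly_0 casimir_H_poly_pCons mult_zero_left)
    then show "z \<in> range casimir_poly" by blast
  qed
qed


section \<open>Central characters\<close>

lemma center_hom_casimir_poly:
  assumes "center_hom \<psi>"
  shows "\<psi> (casimir_poly p) = poly p (\<psi> casimir)"
proof -
  \<comment> \<open>The laws in \<open>center_hom\<close> hold only on the center, so membership is
    recorded first, using the polynomials \<open>1\<close> and \<open>pCons 0 p\<close>.\<close>
  have one: "1 \<in> usl2_center" and mult: "casimir * casimir_poly p \<in> usl2_center" for p
    using casimir_poly_in_center[of 1] casimir_poly_in_center[of "pCons 0 p"]
    by (simp_all add: one_pCons)
  have scalar: "usl2_scalar c \<in> usl2_center" for c
    by (simp add: usl2_center_def usl2_scalar_central)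
  note hom = assms[unfolded center_hom_def]
  have \<psi>_scalar: "\<psi> (usl2_scalar c) = c" for c
    using hom one by (metis mult.right_neutral)
  show ?thesis
  proof (induction p)
    case 0
    then show ?case using \<psi>_scalar[of 0] by simp
  next
    case (pCons c p)
    then show ?case
      using hom mult scalar casimir_in_center casimir_poly_in_center by (simp add: \<psi>_scalar)
  qed
qed

text \<open>By \<open>usl2_center_eq\<close> the element \<open>c_2\<close> generates the center;
  extensionality settles the values outside it.\<close>

lemma center_hom_eqI:
  assumes "center_hom \<psi>" "center_hom \<kappa>" "\<psi> casimir = \<kappa> casimir"
  shows "\<psi> = \<kappa>"
proof (rule extensionalityI[of _ usl2_center])
  show "\<psi> \<in> extensional usl2_center" "\<kappa> \<in> extensional usl2_center"
    using assms by (simp_all add: center_hom_def)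
next
  fix z assume "z \<in> usl2_center"
  then show "\<psi> z = \<kappa> z"
    using assms by (auto simp: usl2_center_eq center_hom_casimir_poly)
qed

text \<open>A scalar is recovered from its action on the polynomial 1 (\<open>eqI\<close>). Hence
  the homomorphism laws of the chosen scalars \<open>g\<close> follow from the module laws, and
  uniqueness follows likewise.\<close>

lemma ex1_central_character:
  fixes N :: "usl2 \<Rightarrow> complex poly \<Rightarrow> complex poly"
  assumes "usl2_module smult N" and "\<And>z. z \<in> usl2_center \<Longrightarrow> \<exists>c. \<forall>f. N z f = smult c f"
  shows "\<exists>!\<kappa>. is_central_character smult N \<kappa>"
proof -
  interpret usl2_module smult N by fact
  from assms(2) obtain g where g: "\<And>z f. z \<in> usl2_center \<Longrightarrow> N z f = smult (g z) f"
    by metis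
  have eqI: "c = d" if "\<And>f :: complex poly. smult c f = smult d f" for c d :: complex
    using that[of 1] by simp
  have center: "y + z \<in> usl2_center" "y * z \<in> usl2_center"
    if "y \<in> usl2_center" "z \<in> usl2_center" for y z
  proof -
    have comm: "y * u = u * y" "z * u = u * z" for u
      using that by (simp_all add: usl2_center_def)
    show "y + z \<in> usl2_center"
      unfolding usl2_center_def by (simp add: distrib_left distrib_right comm)
    show "y * z \<in> usl2_center"
      unfolding usl2_center_def by (simp, metis comm mult.assoc)
  qed
  have scalar: "usl2_scalar c \<in> usl2_center" for c
    by (simp add: usl2_center_def usl2_scalar_central)
  note center = center center(2)[OF scalar] scalar[of 1, unfolded usl2_scalar_1]
  have "center_hom (restrict g usl2_center)"
    unfolding center_hom_def
  proof (intro conjI ballI allI)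
    fix y z c assume y: "y \<in> usl2_center" and z: "z \<in> usl2_center"
    have "g (y + z) = g y + g z"
      by (rule eqI) (use y z in \<open>simp add: center act_add smult_add_left flip: g\<close>)
    then show "restrict g usl2_center (y + z)
        = restrict g usl2_center y + restrict g usl2_center z"
      by (simp add: y z center)
    have "g (y * z) = g y * g z"
      by (rule eqI) (use y z in \<open>simp add: center act_mult flip: g smult_smult\<close>)
    then show "restrict g usl2_center (y * z)
        = restrict g usl2_center y * restrict g usl2_center z"
      by (simp add: y z center)
  next
    fix c z assume z: "z \<in> usl2_center"
    have "g (usl2_scalar c * z) = c * g z"
      by (rule eqI) (use z in \<open>simp add: center act_mult act_scalar flip: g smult_smult\<close>)
    then show "restrict g usl2_center (usl2_scalar c * z) = c * restrict g usl2_center z"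
      by (simp add: z center)
  next
    have "g 1 = 1"
      by (rule eqI) (use act_scalar[of 1] center in \<open>simp flip: g\<close>)
    then show "restrict g usl2_center 1 = 1"
      using center by simp
  qed simp
  then have "is_central_character smult N (restrict g usl2_center)"
    by (simp add: is_central_character_def g)
  moreover have "\<kappa> = \<kappa>'"
    if "is_central_character smult N \<kappa>" "is_central_character smult N \<kappa>'" for \<kappa> \<kappa>'
  proof (rule extensionalityI[of _ usl2_center])
    show "\<kappa> \<in> extensional usl2_center" "\<kappa>' \<in> extensional usl2_center"
      using that by (simp_all add: is_central_character_def center_hom_def)
    show "\<kappa> z = \<kappa>' z" if "z \<in> usl2_center" for z
      by (rule eqI) (metis \<open>is_central_character smult N \<kappa>\<close> \<open>is_central_character smult N \<kappa>'\<close>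
          is_central_character_def that)
  qed
  ultimately show ?thesis by blast
qed

section \<open>Effect of the twists on central elements\<close>

lemma usl2_automorphism_center:
  assumes "usl2_automorphism \<Phi>" "z \<in> usl2_center"
  shows "\<Phi> z \<in> usl2_center"
proof -
  have "\<Phi> z * u = u * \<Phi> z" for u
  proof -
    obtain v where "u = \<Phi> v"
      using assms(1) by (metis bij_pointE usl2_automorphism_def)
    with assms show ?thesis
      by (metis (mono_tags, lifting) mem_Collect_eq usl2_automorphism_def usl2_center_def)
  qed
  then show ?thesis by (simp add: usl2_center_def)
qed

text \<open>The diagonal map fixes \<open>h\<close> and scales \<open>e_12\<close> and
  \<open>e_21\<close> by reciprocal factors, which cancel in both mixed products.\<close>

lemma usl2_diag_casimir:
  assumes a: "a $ 1 \<noteq> 0" "a $ 2 \<noteq> 0"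
  shows "usl2_diag a casimir = casimir"
proof -
  note hom = usl2_map_hom[OF sl2_endomorphism_diag[OF a]]
  have h: "sl2_diag a sl2_h = sl2_h"
    by (rule sl2_eqI) (use a in \<open>simp add: Rep_sl2_diag sl2_h.rep_eq mat_unit_def\<close>)
  have e: "sl2_diag a sl2_e12 = sl2_scale (a $ 1 / a $ 2) sl2_e12"
    by (rule sl2_eqI)
      (use a in \<open>simp add: Rep_sl2_diag sl2_scale.rep_eq sl2_e12.rep_eq mat_unit_def\<close>)
  have f: "sl2_diag a sl2_e21 = sl2_scale (a $ 2 / a $ 1) sl2_e21"
    by (rule sl2_eqI)
      (use a in \<open>simp add: Rep_sl2_diag sl2_scale.rep_eq sl2_e21.rep_eq mat_unit_def\<close>)
  have scal: "(usl2_scalar c * u) * (usl2_scalar d * v) = u * v" if "c * d = 1" for c d u v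
    by (metis mult.assoc mult_1 that usl2_scalar_1 usl2_scalar_central usl2_scalar_mult)
  show ?thesis
    using a by (simp add: casimir_def usl2_diag_def power2_eq_square mult_2 hom h e f
        usl2_gen_scale scal)
qed

text \<open>The signs cancel in pairs, and the two mixed products are exchanged.\<close>

lemma usl2_tau_casimir: "usl2_tau casimir = casimir"
proof -
  note hom = usl2_map_hom[OF sl2_endomorphism_tau]
  have h: "sl2_tau sl2_h = - sl2_h"
    by (rule sl2_eqI)
      (auto simp: sl2_tau.rep_eq uminus_sl2.rep_eq sl2_h.rep_eq mat_unit_def transpose_def)
  have e: "sl2_tau sl2_e12 = - sl2_e21"
    by (rule sl2_eqI)
      (auto simp: sl2_tau.rep_eq uminus_sl2.rep_eq sl2_e12.rep_eq sl2_e21.rep_eq mat_unit_def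
        transpose_def)
  have f: "sl2_tau sl2_e21 = - sl2_e12"
    by (rule sl2_eqI)
      (auto simp: sl2_tau.rep_eq uminus_sl2.rep_eq sl2_e12.rep_eq sl2_e21.rep_eq mat_unit_def
        transpose_def)
  show ?thesis
    by (simp add: casimir_def usl2_tau_def power2_eq_square mult_2 hom h e f usl2_gen_uminus
        add_ac)
qed

text \<open>Collects the properties that yield the central character and survive twisting, so that
  one rule handles all three modules.\<close>

definition casimir_module :: "complex \<Rightarrow> (usl2 \<Rightarrow> complex poly \<Rightarrow> complex poly) \<Rightarrow> bool"
  where "casimir_module m N \<longleftrightarrow> usl2_module smult N \<and>
    (\<forall>z\<in>usl2_center. \<exists>c. \<forall>f. N z f = smult c f) \<and> (\<forall>f. N casimir f = smult m f)"

lemma casimir_module_twist: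
  assumes "usl2_automorphism \<Phi>" "\<Phi> casimir = casimir" "casimir_module m N"
  shows "casimir_module m (twist \<Phi> N)"
  unfolding casimir_module_def
proof (intro conjI)
  show "usl2_module smult (twist \<Phi> N)"
    using assms by (intro usl2_module_twist) (simp_all add: casimir_module_def)
  show "\<forall>z\<in>usl2_center. \<exists>c. \<forall>f. twist \<Phi> N z f = smult c f"
    using assms usl2_automorphism_center unfolding casimir_module_def twist_def by blast
  show "\<forall>f. twist \<Phi> N casimir f = smult m f"
    using assms unfolding casimir_module_def twist_def by metis
qed

text \<open>The last conjunct makes precise that the value at \<open>c_2\<close> determines the
  character.\<close>

theorem proposition15:
  fixes a b :: complex
    and N :: "usl2 \<Rightarrow> complex poly \<Rightarrow> complex poly"
  assumes "a \<noteq> 0"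
    and "N \<in> {twist (usl2_diag (vector [a, 1])) (M_mod b),
              twist (usl2_diag (vector [a, 1])) (M_mod' b),
              twist usl2_tau (twist (usl2_diag (vector [a, 1])) (M_mod' b))}"
  shows "(\<exists>!\<kappa>. is_central_character smult N \<kappa>) \<and>
    central_character smult N casimir = 2 * b * (b + 1) \<and>
    (\<forall>\<psi>. center_hom \<psi> \<and> \<psi> casimir = 2 * b * (b + 1) \<longrightarrow> \<psi> = central_character smult N)"
proof -
  define m where "m = 2 * b * (b + 1)"
  have "casimir_module m (M_mod b)" "casimir_module m (M_mod' b)"
    by (simp_all add: casimir_module_def m_def usl2_module_M_mod usl2_module_M_mod'
        center_acts_by_scalar_M_mod center_acts_by_scalar_M_mod'
        casimir_acts_M_mod casimir_acts_M_mod')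
  moreover have "usl2_automorphism (usl2_diag (vector [a, 1]))"
    "usl2_diag (vector [a, 1]) casimir = casimir"
    using assms(1) by (simp_all add: usl2_automorphism_diag usl2_diag_casimir)
  ultimately have N: "casimir_module m N"
    using assms(2) by (auto intro!: casimir_module_twist usl2_automorphism_tau usl2_tau_casimir)
  then have ex1: "\<exists>!\<kappa>. is_central_character smult N \<kappa>"
    by (intro ex1_central_character) (simp_all add: casimir_module_def)
  then have cc: "is_central_character smult N (central_character smult N)"
    unfolding central_character_def by (rule theI')
  \<comment> \<open>Both sides are the action of \<open>c_2\<close> on the polynomial 1.\<close>
  then have "smult (central_character smult N casimir) 1 = smult m (1 :: complex poly)"
    using N casimir_in_center by (metis casimir_module_def is_central_character_def)
  then have "central_character smult N casimir = m"
    by simp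
  then show ?thesis
    using ex1 cc center_hom_eqI unfolding m_def is_central_character_def by metis
qed

end
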